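(* Let $\mathcal{B}$ be a block schema such that $\vdash\mathcal{B}$ (i.e. $\mathcal{B}$ is well-formed) is derivable. Then for any variable permutation $\pi$, $\vdash\pi.\mathcal{B}$ is derivable.
   Context: Canonical LF over a fixed well-formed signature $\Sigma$: types $A ::= P\mid\Pi x{:}A.B$, $P ::= a\mid P\,M$, terms $M ::= R\mid\lambda x.M$, $R ::= c\mid x\mid R\,M$ (only $\beta$-normal forms). Arity types are simple types over one base type $o$ built with $\to$; erasure: $P^-=o$, $(\Pi x{:}A_1.A_2)^-=A_1^-\to A_2^-$; $\Sigma^-=\{c{:}A^-\mid c{:}A\in\Sigma\}$. An arity context $\Theta$ assigns arity types to constants, nominal constants and variables; $\Theta\vdash A$ (arity kinding) checks that a type is canonical and respects the functional structure given by erased types. A substitution is a finite set $\theta=\{\langle x_i,M_i,\alpha_i\rangle\}$ (distinct variables, canonical terms, arity types); $E[\theta]$ is its hereditary application (capture-avoiding replacement followed by normalization guided by the arity types), possibly undefined. Block schemas. Block declarations $\Delta ::= \cdot\mid\Delta,y{:}A$; block schemas $\mathcal{B}=\{x_1{:}\alpha_1,\ldots,x_n{:}\alpha_n\}\Delta$. Well-formedness $\vdash\mathcal{B}$: the $x_i$ are distinct variables and $\Sigma^-\cup\{x_1{:}\alpha_1,\ldots,x_n{:}\alpha_n\}\vdash\Delta\Rightarrow\Theta'$ for some $\Theta'$, where $\Theta\vdash\cdot\Rightarrow\Theta$, and $\Theta\vdash\Delta,y{:}A\Rightarrow\Theta'\cup\{y{:}A^-\}$ whenever $\Theta\vdash\Delta\Rightarrow\Theta'$,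 $y$ is not assigned by $\Theta'$, and $\Theta'\vdash A$. Variants. A variable permutation $\pi$ is a bijection on variables that is the identity except at finitely many points; $\pi.x$ is its value at $x$. For an arity context $\Theta$, the permutation substitution is $\pi_\Theta=\{\langle x,\pi.x,\alpha'\rangle\mid\pi.x\ne x\}$ with $\alpha'=\alpha$ if $x{:}\alpha\in\Theta$ and $\alpha'=o$ otherwise. For $\mathcal{B}=\{x_1{:}\alpha_1,\ldots,x_n{:}\alpha_n\}y_1{:}A_1,\ldots,y_m{:}A_m$, let $\Theta_{\mathcal{B}}=\Sigma^-\cup\{x_1{:}\alpha_1,\ldots,x_n{:}\alpha_n,y_1{:}A_1^-,\ldots,y_m{:}A_m^-\}$ and $\pi.\mathcal{B}=\{\pi.x_1{:}\alpha_1,\ldots,\pi.x_n{:}\alpha_n\}\,\pi.y_1{:}A_1[\pi_{\Theta_{\mathcal{B}}}],\ldots,\pi.y_m{:}A_m[\pi_{\Theta_{\mathcal{B}}}]$; these hereditary substitutions are defined under the well-formedness assumption. *)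

theory Defs
  imports Main
begin

section \<open>Syntax of canonical LF\<close>

text \<open>
  Expressions are represented in a locally nameless style: variables that are not bound
  inside the expression are named, and variables bound by \<open>\<lambda>\<close> or \<open>\<Pi>\<close> are de Bruijn indices.
  Expressions that differ only in the names of bound variables are therefore equal, and
  capture cannot occur.
\<close>

type_synonym name = string

datatype head =
    Const name
  | Nom name      \<comment> \<open>nominal constants\<close>
  | Var name
  | Bnd nat

datatype trm = At atm | Lam trm
  and atm = Hd head | App atm trm

datatype fam = TConst name | FApp fam trm

datatype ty = Fam fam | Pi ty ty

datatype kind = Type | KPi ty kind

datatype arity = Base | Arr arity arity  (infixr \<open>\<rightarrow>\<^sub>a\<close> 65)

fun erase :: "ty \<Rightarrow> arity" where
  "erase (Fam P) = Base"
| "erase (Pi A B) = erase A \<rightarrow>\<^sub>a erase B"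

text \<open>The arities of the arguments that a type constant of the given kind expects.\<close>

fun kind_args :: "kind \<Rightarrow> arity list" where
  "kind_args Type = []"
| "kind_args (KPi A K) = erase A # kind_args K"

text \<open>\<open>shift k\<close> increments all indices that are at least \<open>k\<close>.\<close>

fun shift_head :: "nat \<Rightarrow> head \<Rightarrow> head" where
  "shift_head k (Bnd i) = Bnd (if i < k then i else Suc i)"
| "shift_head k h = h"

primrec shift :: "nat \<Rightarrow> trm \<Rightarrow> trm"
  and shift_atm :: "nat \<Rightarrow> atm \<Rightarrow> atm" where
  "shift k (At R) = At (shift_atm k R)"
| "shift k (Lam M) = Lam (shift (Suc k) M)"
| "shift_atm k (Hd h) = Hd (shift_head k h)"
| "shift_atm k (App R M) = App (shift_atm k R) (shift k M)"

primrec shift_fam :: "nat \<Rightarrow> fam \<Rightarrow> fam" where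
  "shift_fam k (TConst a) = TConst a"
| "shift_fam k (FApp P M) = FApp (shift_fam k P) (shift k M)"

primrec shift_ty :: "nat \<Rightarrow> ty \<Rightarrow> ty" where
  "shift_ty k (Fam P) = Fam (shift_fam k P)"
| "shift_ty k (Pi A B) = Pi (shift_ty k A) (shift_ty (Suc k) B)"


section \<open>Hereditary substitution\<close>

text \<open>
  A substitution \<open>{\<langle>x\<^sub>i, M\<^sub>i, \<alpha>\<^sub>i\<rangle>}\<close> is a map on variable names. To treat uniformly the named
  variables, the indices bound on the way into an expression and the index contracted by a
  \<open>\<beta>\<close>-step, the rules work with environments that say, for every head, whether it is kept
  (possibly renumbered) or replaced by a term of a given arity.
\<close>

type_synonym subst = "name \<rightharpoonup> trm \<times> arity"

datatype entry = Keep head | Repl trm arity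

type_synonym env = "head \<Rightarrow> entry"

fun shift_entry :: "entry \<Rightarrow> entry" where
  "shift_entry (Keep h) = Keep (shift_head 0 h)"
| "shift_entry (Repl M \<alpha>) = Repl (shift 0 M) \<alpha>"

fun lift :: "env \<Rightarrow> env" where
  "lift \<sigma> (Bnd 0) = Keep (Bnd 0)"
| "lift \<sigma> (Bnd (Suc i)) = shift_entry (\<sigma> (Bnd i))"
| "lift \<sigma> h = shift_entry (\<sigma> h)"

fun env_of :: "subst \<Rightarrow> env" where
  "env_of \<theta> (Var x) = (case \<theta> x of None \<Rightarrow> Keep (Var x) | Some (M, \<alpha>) \<Rightarrow> Repl M \<alpha>)"
| "env_of \<theta> h = Keep h"

text \<open>The environment that replaces the variable of an outermost binder being removed.\<close>

fun beta_env :: "trm \<Rightarrow> arity \<Rightarrow> env" where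
  "beta_env M \<alpha> (Bnd 0) = Repl M \<alpha>"
| "beta_env M \<alpha> (Bnd (Suc i)) = Keep (Bnd i)"
| "beta_env M \<alpha> h = Keep h"

text \<open>
  On an atomic term the result is either again an atomic term whose head was kept
  (\<open>hsub_keep\<close>), or, if the head was replaced, a canonical term together with its arity
  (\<open>hsub_repl\<close>). In the latter case an application is contracted hereditarily if its function
  part has become an abstraction (\<open>repl_beta\<close>). If the function part has become an atomic
  term (\<open>repl_atm\<close>), as happens when a variable of functional arity is replaced by a bare
  variable, then the application is already normal.
\<close>

inductive hsub :: "env \<Rightarrow> trm \<Rightarrow> trm \<Rightarrow> bool"
  and hsub_keep :: "env \<Rightarrow> atm \<Rightarrow> atm \<Rightarrow> bool"
  and hsub_repl :: "env \<Rightarrow> atm \<Rightarrow> trm \<Rightarrow> arity \<Rightarrow> bool" where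
  hsub_at_keep: "hsub_keep \<sigma> R R' \<Longrightarrow> hsub \<sigma> (At R) (At R')"
| hsub_at_repl: "hsub_repl \<sigma> R M \<alpha> \<Longrightarrow> hsub \<sigma> (At R) M"
| hsub_lam: "hsub (lift \<sigma>) M M' \<Longrightarrow> hsub \<sigma> (Lam M) (Lam M')"
| keep_hd: "\<sigma> h = Keep h' \<Longrightarrow> hsub_keep \<sigma> (Hd h) (Hd h')"
| keep_app: "\<lbrakk>hsub_keep \<sigma> R R'; hsub \<sigma> M M'\<rbrakk> \<Longrightarrow> hsub_keep \<sigma> (App R M) (App R' M')"
| repl_hd: "\<sigma> h = Repl M \<alpha> \<Longrightarrow> hsub_repl \<sigma> (Hd h) M \<alpha>"
| repl_beta: "\<lbrakk>hsub_repl \<sigma> R (Lam N) (\<alpha> \<rightarrow>\<^sub>a \<beta>); hsub \<sigma> M M'; hsub (beta_env M' \<alpha>) N N'\<rbrakk>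
    \<Longrightarrow> hsub_repl \<sigma> (App R M) N' \<beta>"
| repl_atm: "\<lbrakk>hsub_repl \<sigma> R (At R') (\<alpha> \<rightarrow>\<^sub>a \<beta>); hsub \<sigma> M M'\<rbrakk>
    \<Longrightarrow> hsub_repl \<sigma> (App R M) (At (App R' M')) \<beta>"

inductive hsub_fam :: "env \<Rightarrow> fam \<Rightarrow> fam \<Rightarrow> bool" where
  "hsub_fam \<sigma> (TConst a) (TConst a)"
| "\<lbrakk>hsub_fam \<sigma> P P'; hsub \<sigma> M M'\<rbrakk> \<Longrightarrow> hsub_fam \<sigma> (FApp P M) (FApp P' M')"

inductive hsub_ty :: "env \<Rightarrow> ty \<Rightarrow> ty \<Rightarrow> bool" where
  "hsub_fam \<sigma> P P' \<Longrightarrow> hsub_ty \<sigma> (Fam P) (Fam P')"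
| "\<lbrakk>hsub_ty \<sigma> A A'; hsub_ty (lift \<sigma>) B B'\<rbrakk> \<Longrightarrow> hsub_ty \<sigma> (Pi A B) (Pi A' B')"

inductive hsub_kind :: "env \<Rightarrow> kind \<Rightarrow> kind \<Rightarrow> bool" where
  "hsub_kind \<sigma> Type Type"
| "\<lbrakk>hsub_ty \<sigma> A A'; hsub_kind (lift \<sigma>) K K'\<rbrakk> \<Longrightarrow> hsub_kind \<sigma> (KPi A K) (KPi A' K')"

inductive_cases hsub_at_cases: "hsub \<sigma> (At R) N"
inductive_cases hsub_lam_cases: "hsub \<sigma> (Lam M) N"
inductive_cases keep_hd_cases: "hsub_keep \<sigma> (Hd h) R"
inductive_cases keep_app_cases: "hsub_keep \<sigma> (App R M) R'"
inductive_cases repl_hd_cases: "hsub_repl \<sigma> (Hd h) N \<alpha>"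
inductive_cases repl_app_cases: "hsub_repl \<sigma> (App R M) N \<alpha>"
inductive_cases hsub_fam_const_cases: "hsub_fam \<sigma> (TConst a) P"
inductive_cases hsub_fam_app_cases: "hsub_fam \<sigma> (FApp P M) P'"
inductive_cases hsub_ty_fam_cases: "hsub_ty \<sigma> (Fam P) A"
inductive_cases hsub_ty_pi_cases: "hsub_ty \<sigma> (Pi A B) A'"

lemma hsub_unique_aux:
  "hsub \<sigma> M M' \<Longrightarrow> (\<forall>M''. hsub \<sigma> M M'' \<longrightarrow> M'' = M')"
  "hsub_keep \<sigma> R R' \<Longrightarrow>
     (\<forall>R''. hsub_keep \<sigma> R R'' \<longrightarrow> R'' = R') \<and> (\<forall>N \<alpha>. \<not> hsub_repl \<sigma> R N \<alpha>)"
  "hsub_repl \<sigma> R N \<alpha> \<Longrightarrow>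
     (\<forall>N' \<alpha>'. hsub_repl \<sigma> R N' \<alpha>' \<longrightarrow> N' = N \<and> \<alpha>' = \<alpha>) \<and> (\<forall>R'. \<not> hsub_keep \<sigma> R R')"
proof (induction rule: hsub_hsub_keep_hsub_repl.inducts)
  case (hsub_at_keep \<sigma> R R')
  then show ?case by (metis hsub_at_cases)
next
  case (hsub_at_repl \<sigma> R M \<alpha>)
  then show ?case by (metis hsub_at_cases)
next
  case (hsub_lam \<sigma> M M')
  then show ?case by (metis hsub_lam_cases)
next
  case (keep_hd \<sigma> h h')
  then show ?case by (auto elim: keep_hd_cases repl_hd_cases)
next
  case (keep_app \<sigma> R R' M M')
  then show ?case by (metis keep_app_cases repl_app_cases)
next
  case (repl_hd \<sigma> h M \<alpha>)
  then show ?case by (auto elim: keep_hd_cases repl_hd_cases)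
next
  case (repl_beta \<sigma> R N \<alpha> \<beta> M M' N')
  have "N0 = N' \<and> \<beta>0 = \<beta>" if "hsub_repl \<sigma> (App R M) N0 \<beta>0" for N0 \<beta>0
    using that
  proof (cases rule: repl_app_cases[consumes 1])
    case (1 N1 \<alpha>1 M1)
    then have "N1 = N" "\<alpha>1 = \<alpha>" "\<beta>0 = \<beta>" "M1 = M'" using repl_beta.IH by blast+
    then show ?thesis using 1 repl_beta.IH by blast
  next
    case (2 R1 \<alpha>1 M1)
    then show ?thesis using repl_beta.IH by blast
  qed
  then show ?case using repl_beta.IH by (blast elim: keep_app_cases)
next
  case (repl_atm \<sigma> R R' \<alpha> \<beta> M M')
  have "N0 = At (App R' M') \<and> \<beta>0 = \<beta>" if "hsub_repl \<sigma> (App R M) N0 \<beta>0" for N0 \<beta>0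
    using that
  proof (cases rule: repl_app_cases[consumes 1])
    case (1 N1 \<alpha>1 M1)
    then show ?thesis using repl_atm.IH by blast
  next
    case (2 R1 \<alpha>1 M1)
    then have "R1 = R'" "\<beta>0 = \<beta>" "M1 = M'" using repl_atm.IH by blast+
    then show ?thesis using 2 by blast
  qed
  then show ?case using repl_atm.IH by (blast elim: keep_app_cases)
qed

lemma hsub_unique: "\<lbrakk>hsub \<sigma> M M'; hsub \<sigma> M M''\<rbrakk> \<Longrightarrow> M'' = M'"
  using hsub_unique_aux(1) by blast

lemma hsub_fam_unique: "\<lbrakk>hsub_fam \<sigma> P P'; hsub_fam \<sigma> P P''\<rbrakk> \<Longrightarrow> P'' = P'"
  by (induction arbitrary: P'' rule: hsub_fam.induct)
    (blast elim: hsub_fam_const_cases hsub_fam_app_cases dest: hsub_unique)+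

lemma hsub_ty_unique: "\<lbrakk>hsub_ty \<sigma> A A'; hsub_ty \<sigma> A A''\<rbrakk> \<Longrightarrow> A'' = A'"
  by (induction arbitrary: A'' rule: hsub_ty.induct)
    (blast elim: hsub_ty_fam_cases hsub_ty_pi_cases dest: hsub_fam_unique)+

text \<open>\<open>A[\<theta>]\<close>, which is \<open>None\<close> when the hereditary application is undefined; the description is
  justified by \<open>hsub_ty_unique\<close>.\<close>

definition subst_ty :: "subst \<Rightarrow> ty \<Rightarrow> ty option" where
  "subst_ty \<theta> A =
     (if \<exists>A'. hsub_ty (env_of \<theta>) A A' then Some (THE A'. hsub_ty (env_of \<theta>) A A') else None)"

lemma subst_ty_eq_Some_iff: "subst_ty \<theta> A = Some A' \<longleftrightarrow> hsub_ty (env_of \<theta>) A A'"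
proof -
  have "(THE B. hsub_ty (env_of \<theta>) A B) = B" if "hsub_ty (env_of \<theta>) A B" for B
    using that hsub_ty_unique by blast
  then show ?thesis
    by (auto simp: subst_ty_def)
qed


section \<open>Well-formed signatures\<close>

text \<open>Signatures are lists with the most recent declaration first.\<close>

datatype decl = TyDecl name kind | TmDecl name ty

type_synonym signature = "decl list"

text \<open>
  In a signature the declared types and kinds have no free variables, so that typing contexts
  only have to record the types of enclosing binders: \<open>\<Gamma> ! i\<close> is the type of \<open>Bnd i\<close>, in the
  scope of the entries behind it, whence the shifts in \<open>syn_bnd\<close>. Atomic terms are checked
  only against atomic types, so well-typed terms are \<open>\<eta>\<close>-long.
\<close>

inductive lf_check :: "signature \<Rightarrow> ty list \<Rightarrow> trm \<Rightarrow> ty \<Rightarrow> bool"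
  and lf_syn :: "signature \<Rightarrow> ty list \<Rightarrow> atm \<Rightarrow> ty \<Rightarrow> bool"
  for \<Sigma> :: signature where
  check_at: "lf_syn \<Sigma> \<Gamma> R (Fam P) \<Longrightarrow> lf_check \<Sigma> \<Gamma> (At R) (Fam P)"
| check_lam: "lf_check \<Sigma> (A # \<Gamma>) M B \<Longrightarrow> lf_check \<Sigma> \<Gamma> (Lam M) (Pi A B)"
| syn_const: "TmDecl c A \<in> set \<Sigma> \<Longrightarrow> lf_syn \<Sigma> \<Gamma> (Hd (Const c)) A"
| syn_bnd: "i < length \<Gamma> \<Longrightarrow> lf_syn \<Sigma> \<Gamma> (Hd (Bnd i)) ((shift_ty 0 ^^ Suc i) (\<Gamma> ! i))"
| syn_app: "\<lbrakk>lf_syn \<Sigma> \<Gamma> R (Pi A B); lf_check \<Sigma> \<Gamma> M A; hsub_ty (beta_env M (erase A)) B B'\<rbrakk>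
    \<Longrightarrow> lf_syn \<Sigma> \<Gamma> (App R M) B'"

inductive lf_fam :: "signature \<Rightarrow> ty list \<Rightarrow> fam \<Rightarrow> kind \<Rightarrow> bool" for \<Sigma> :: signature where
  "TyDecl a K \<in> set \<Sigma> \<Longrightarrow> lf_fam \<Sigma> \<Gamma> (TConst a) K"
| "\<lbrakk>lf_fam \<Sigma> \<Gamma> P (KPi A K); lf_check \<Sigma> \<Gamma> M A; hsub_kind (beta_env M (erase A)) K K'\<rbrakk>
    \<Longrightarrow> lf_fam \<Sigma> \<Gamma> (FApp P M) K'"

inductive lf_ty :: "signature \<Rightarrow> ty list \<Rightarrow> ty \<Rightarrow> bool" for \<Sigma> :: signature where
  "lf_fam \<Sigma> \<Gamma> P Type \<Longrightarrow> lf_ty \<Sigma> \<Gamma> (Fam P)"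
| "\<lbrakk>lf_ty \<Sigma> \<Gamma> A; lf_ty \<Sigma> (A # \<Gamma>) B\<rbrakk> \<Longrightarrow> lf_ty \<Sigma> \<Gamma> (Pi A B)"

inductive lf_kind :: "signature \<Rightarrow> ty list \<Rightarrow> kind \<Rightarrow> bool" for \<Sigma> :: signature where
  "lf_kind \<Sigma> \<Gamma> Type"
| "\<lbrakk>lf_ty \<Sigma> \<Gamma> A; lf_kind \<Sigma> (A # \<Gamma>) K\<rbrakk> \<Longrightarrow> lf_kind \<Sigma> \<Gamma> (KPi A K)"

inductive wf_sig :: "signature \<Rightarrow> bool" where
  "wf_sig []"
| "\<lbrakk>wf_sig \<Sigma>; lf_kind \<Sigma> [] K; \<forall>K'. TyDecl a K' \<notin> set \<Sigma>\<rbrakk> \<Longrightarrow> wf_sig (TyDecl a K # \<Sigma>)"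
| "\<lbrakk>wf_sig \<Sigma>; lf_ty \<Sigma> [] A; \<forall>A'. TmDecl c A' \<notin> set \<Sigma>\<rbrakk> \<Longrightarrow> wf_sig (TmDecl c A # \<Sigma>)"


section \<open>Arity typing and arity kinding\<close>

text \<open>An arity context assigns arities to constants, nominal constants, and variables, the
  latter including those bound by an enclosing binder.\<close>

type_synonym arity_ctx = "head \<rightharpoonup> arity"

text \<open>The arity context for the body of a binder whose variable has arity \<open>\<alpha>\<close>.\<close>

fun bind_arity :: "arity \<Rightarrow> arity_ctx \<Rightarrow> arity_ctx" where
  "bind_arity \<alpha> \<Theta> (Bnd 0) = Some \<alpha>"
| "bind_arity \<alpha> \<Theta> (Bnd (Suc i)) = \<Theta> (Bnd i)"
| "bind_arity \<alpha> \<Theta> h = \<Theta> h"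

text \<open>Arity typing does not ask for \<open>\<eta>\<close>-long forms: an atomic term may have any arity.\<close>

inductive arity_trm :: "arity_ctx \<Rightarrow> trm \<Rightarrow> arity \<Rightarrow> bool"
  and arity_atm :: "arity_ctx \<Rightarrow> atm \<Rightarrow> arity \<Rightarrow> bool" where
  "arity_atm \<Theta> R \<alpha> \<Longrightarrow> arity_trm \<Theta> (At R) \<alpha>"
| "arity_trm (bind_arity \<alpha> \<Theta>) M \<beta> \<Longrightarrow> arity_trm \<Theta> (Lam M) (\<alpha> \<rightarrow>\<^sub>a \<beta>)"
| "\<Theta> h = Some \<alpha> \<Longrightarrow> arity_atm \<Theta> (Hd h) \<alpha>"
| "\<lbrakk>arity_atm \<Theta> R (\<alpha> \<rightarrow>\<^sub>a \<beta>); arity_trm \<Theta> M \<alpha>\<rbrakk> \<Longrightarrow> arity_atm \<Theta> (App R M) \<beta>"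

text \<open>\<open>arity_fam \<Sigma> \<Theta> P \<alpha>s\<close>: the atomic type \<open>P\<close> expects further arguments of arities \<open>\<alpha>s\<close>.\<close>

inductive arity_fam :: "signature \<Rightarrow> arity_ctx \<Rightarrow> fam \<Rightarrow> arity list \<Rightarrow> bool"
  for \<Sigma> :: signature where
  "TyDecl a K \<in> set \<Sigma> \<Longrightarrow> arity_fam \<Sigma> \<Theta> (TConst a) (kind_args K)"
| "\<lbrakk>arity_fam \<Sigma> \<Theta> P (\<alpha> # \<alpha>s); arity_trm \<Theta> M \<alpha>\<rbrakk> \<Longrightarrow> arity_fam \<Sigma> \<Theta> (FApp P M) \<alpha>s"

inductive arity_ty :: "signature \<Rightarrow> arity_ctx \<Rightarrow> ty \<Rightarrow> bool" for \<Sigma> :: signature where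
  "arity_fam \<Sigma> \<Theta> P [] \<Longrightarrow> arity_ty \<Sigma> \<Theta> (Fam P)"
| "\<lbrakk>arity_ty \<Sigma> \<Theta> A; arity_ty \<Sigma> (bind_arity (erase A) \<Theta>) B\<rbrakk> \<Longrightarrow> arity_ty \<Sigma> \<Theta> (Pi A B)"

fun sig_arities :: "signature \<Rightarrow> arity_ctx" where
  "sig_arities [] = Map.empty"
| "sig_arities (TyDecl a K # \<Sigma>) = sig_arities \<Sigma>"
| "sig_arities (TmDecl c A # \<Sigma>) = (sig_arities \<Sigma>)(Const c \<mapsto> erase A)"

definition var_arities :: "(name \<times> arity) list \<Rightarrow> arity_ctx" where
  "var_arities xs = map_of (map (\<lambda>(x, \<alpha>). (Var x, \<alpha>)) xs)"


section \<open>Block schemas and their variants\<close>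

text \<open>The schema \<open>{x\<^sub>1:\<alpha>\<^sub>1, \<dots>, x\<^sub>n:\<alpha>\<^sub>n} y\<^sub>1:A\<^sub>1, \<dots>, y\<^sub>m:A\<^sub>m\<close>, both lists in the order written.\<close>

type_synonym block_decl = "(name \<times> ty) list"

datatype block_schema = Block "(name \<times> arity) list" block_decl

inductive wf_decl :: "signature \<Rightarrow> arity_ctx \<Rightarrow> block_decl \<Rightarrow> arity_ctx \<Rightarrow> bool"
  for \<Sigma> :: signature where
  "wf_decl \<Sigma> \<Theta> [] \<Theta>"
| "\<lbrakk>wf_decl \<Sigma> \<Theta> \<Delta> \<Theta>'; \<Theta>' (Var y) = None; arity_ty \<Sigma> \<Theta>' A\<rbrakk>
    \<Longrightarrow> wf_decl \<Sigma> \<Theta> (\<Delta> @ [(y, A)]) (\<Theta>'(Var y \<mapsto> erase A))"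

inductive wf_block :: "signature \<Rightarrow> block_schema \<Rightarrow> bool" for \<Sigma> :: signature where
  "\<lbrakk>distinct (map fst xs); wf_decl \<Sigma> (sig_arities \<Sigma> ++ var_arities xs) \<Delta> \<Theta>'\<rbrakk>
    \<Longrightarrow> wf_block \<Sigma> (Block xs \<Delta>)"

definition var_perm :: "(name \<Rightarrow> name) \<Rightarrow> bool" where
  "var_perm \<pi> \<longleftrightarrow> bij \<pi> \<and> finite {x. \<pi> x \<noteq> x}"

definition perm_subst :: "(name \<Rightarrow> name) \<Rightarrow> arity_ctx \<Rightarrow> subst" where
  "perm_subst \<pi> \<Theta> = (\<lambda>x.
     if \<pi> x = x then None
     else Some (At (Hd (Var (\<pi> x))), case \<Theta> (Var x) of Some \<alpha> \<Rightarrow> \<alpha> | None \<Rightarrow> Base))"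

fun block_arities :: "signature \<Rightarrow> block_schema \<Rightarrow> arity_ctx" where
  "block_arities \<Sigma> (Block xs \<Delta>) =
     sig_arities \<Sigma> ++ var_arities (xs @ map (\<lambda>(y, A). (y, erase A)) \<Delta>)"

text \<open>\<open>\<pi>.\<B>\<close>, which is \<open>None\<close> if one of the hereditary substitutions is undefined.\<close>

fun perm_block :: "signature \<Rightarrow> (name \<Rightarrow> name) \<Rightarrow> block_schema \<Rightarrow> block_schema option" where
  "perm_block \<Sigma> \<pi> (Block xs \<Delta>) =
     (let \<theta> = perm_subst \<pi> (block_arities \<Sigma> (Block xs \<Delta>)) in
      map_option (Block (map (\<lambda>(x, \<alpha>). (\<pi> x, \<alpha>)) xs))
        (those (map (\<lambda>(y, A). map_option (Pair (\<pi> y)) (subst_ty \<theta> A)) \<Delta>)))"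

end

(* Every variable of a well-kinded type is replaced either by itself or by another bare variable
   with its own arity annotated, because the arity context of each declaration agrees with the
   annotating context of the whole block. Hence a replaced head never becomes an abstraction, no
   beta-step arises, and the hereditary substitution is a mere renaming: it is defined, keeps
   erasures, and carries arity kinding over to the permuted context. *)

theory Submission
  imports Defs
begin

text \<open>The invariant to be pushed through an expression. In a \<open>Repl\<close> entry the
  annotation must be the arity that \<open>\<Theta>\<close> assigns, since \<open>repl_atm\<close>
  applies only while the annotation is a function arity.\<close>

definition renames :: "env \<Rightarrow> arity_ctx \<Rightarrow> arity_ctx \<Rightarrow> bool" where
  "renames \<sigma> \<Theta> \<Theta>' \<longleftrightarrow> (\<forall>h \<alpha>. \<Theta> h = Some \<alpha> \<longrightarrow>
     (\<exists>h'. \<Theta>' h' = Some \<alpha> \<and> (\<sigma> h = Keep h' \<or> \<sigma> h = Repl (At (Hd h')) \<alpha>)))"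

lemma bind_arity_shift_head: "bind_arity \<alpha> \<Theta> (shift_head 0 h) = \<Theta> h"
  by (cases h) auto

lemma renames_lift:
  assumes "renames \<sigma> \<Theta> \<Theta>'"
  shows "renames (lift \<sigma>) (bind_arity \<alpha> \<Theta>) (bind_arity \<alpha> \<Theta>')"
  unfolding renames_def
proof (intro allI impI)
  fix h \<beta>
  assume h: "bind_arity \<alpha> \<Theta> h = Some \<beta>"
  show "\<exists>h'. bind_arity \<alpha> \<Theta>' h' = Some \<beta> \<and>
    (lift \<sigma> h = Keep h' \<or> lift \<sigma> h = Repl (At (Hd h')) \<beta>)"
  proof (cases "h = Bnd 0")
    case True
    with h show ?thesis by (auto intro: exI[of _ "Bnd 0"])
  next
    case False
    \<comment> \<open>Any other head is some \<open>g\<close> of the outer context seen from under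
      the binder: the predecessor for an index, the head itself otherwise. Its image is shifted
      along with it.\<close>
    then obtain g where g: "\<Theta> g = Some \<beta>" "lift \<sigma> h = shift_entry (\<sigma> g)"
      using h by (cases "(\<alpha>, \<Theta>, h)" rule: bind_arity.cases) auto
    with assms obtain g' where
      "\<Theta>' g' = Some \<beta>" "\<sigma> g = Keep g' \<or> \<sigma> g = Repl (At (Hd g')) \<beta>"
      unfolding renames_def by blast
    with g show ?thesis
      by (auto simp: bind_arity_shift_head intro!: exI[of _ "shift_head 0 g'"])
  qed
qed

text \<open>The atomic half is strengthened to a replacement that is again atomic and annotated with
  the arity of the original. In an application the annotation is then a function arity, so
  \<open>repl_atm\<close> applies in the replaced case.\<close>

lemma renames_trm_atm:
  "arity_trm \<Theta> M \<alpha> \<Longrightarrow> renames \<sigma> \<Theta> \<Theta>' \<Longrightarrow> \<exists>M'. hsub \<sigma> M M' \<and> arity_trm \<Theta>' M' \<alpha>"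
  "arity_atm \<Theta> R \<alpha> \<Longrightarrow> renames \<sigma> \<Theta> \<Theta>' \<Longrightarrow>
     \<exists>R'. (hsub_keep \<sigma> R R' \<or> hsub_repl \<sigma> R (At R') \<alpha>) \<and> arity_atm \<Theta>' R' \<alpha>"
proof (induction arbitrary: \<sigma> \<Theta>' and \<sigma> \<Theta>' rule: arity_trm_arity_atm.inducts)
  case (1 \<Theta> R \<alpha>)
  then show ?case by (meson arity_trm_arity_atm.intros hsub_at_keep hsub_at_repl)
next
  case (2 \<alpha> \<Theta> M \<beta>)
  then show ?case by (meson arity_trm_arity_atm.intros hsub_lam renames_lift)
next
  case (3 \<Theta> h \<alpha>)
  then show ?case unfolding renames_def by (meson arity_trm_arity_atm.intros keep_hd repl_hd)
next
  case (4 \<Theta> R \<alpha> \<beta> M)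
  then show ?case by (meson arity_trm_arity_atm.intros keep_app repl_atm)
qed

lemma renames_fam:
  assumes "arity_fam \<Sigma> \<Theta> P \<alpha>s" "renames \<sigma> \<Theta> \<Theta>'"
  shows "\<exists>P'. hsub_fam \<sigma> P P' \<and> arity_fam \<Sigma> \<Theta>' P' \<alpha>s"
  using assms
proof (induction rule: arity_fam.induct)
  case (1 a K \<Theta>)
  then show ?case by (meson arity_fam.intros hsub_fam.intros)
next
  case (2 \<Theta> P \<alpha> \<alpha>s M)
  then show ?case by (meson arity_fam.intros hsub_fam.intros renames_trm_atm(1))
qed

text \<open>Erasures are tracked because the body of a \<open>Pi\<close> is kinded under the erasure
  of its domain, and a block declaration extends its context by the erasure of its type.\<close>

lemma renames_ty:
  assumes "arity_ty \<Sigma> \<Theta> A" "renames \<sigma> \<Theta> \<Theta>'"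
  shows "\<exists>A'. hsub_ty \<sigma> A A' \<and> arity_ty \<Sigma> \<Theta>' A' \<and> erase A' = erase A"
  using assms
proof (induction arbitrary: \<sigma> \<Theta>' rule: arity_ty.induct)
  case (1 \<Theta> P)
  then show ?case by (metis arity_ty.intros(1) erase.simps(1) hsub_ty.intros(1) renames_fam)
next
  case (2 \<Theta> A B)
  then obtain A' where A': "hsub_ty \<sigma> A A'" "arity_ty \<Sigma> \<Theta>' A'" "erase A' = erase A"
    by blast
  obtain B' where "hsub_ty (lift \<sigma>) B B'" "arity_ty \<Sigma> (bind_arity (erase A) \<Theta>') B'"
    "erase B' = erase B"
    using 2 renames_lift by blast
  with A' show ?case
    by (intro exI[of _ "Pi A' B'"]) (auto intro: hsub_ty.intros arity_ty.intros)
qed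

fun perm_head :: "(name \<Rightarrow> name) \<Rightarrow> head \<Rightarrow> head" where
  "perm_head \<pi> (Var x) = Var (\<pi> x)"
| "perm_head \<pi> h = h"

text \<open>Transport along \<open>\<pi>\<close>: precomposing with the inverse gives
  \<open>\<pi> x\<close> the arity of \<open>x\<close>.\<close>

definition perm_ctx :: "(name \<Rightarrow> name) \<Rightarrow> arity_ctx \<Rightarrow> arity_ctx" where
  "perm_ctx \<pi> \<Theta> = \<Theta> \<circ> perm_head (inv \<pi>)"

lemma perm_ctx_perm_head: "bij \<pi> \<Longrightarrow> perm_ctx \<pi> \<Theta> (perm_head \<pi> h) = \<Theta> h"
  by (cases h) (auto simp: perm_ctx_def bij_is_inj)

lemma perm_ctx_upd:
  assumes "bij \<pi>"
  shows "perm_ctx \<pi> (\<Theta>(Var y \<mapsto> \<alpha>)) = (perm_ctx \<pi> \<Theta>)(Var (\<pi> y) \<mapsto> \<alpha>)"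
proof
  fix h
  show "perm_ctx \<pi> (\<Theta>(Var y \<mapsto> \<alpha>)) h = ((perm_ctx \<pi> \<Theta>)(Var (\<pi> y) \<mapsto> \<alpha>)) h"
    using assms
    by (cases h) (auto simp: perm_ctx_def bij_is_inj bij_is_surj surj_f_inv_f)
qed

lemma renames_perm_subst:
  assumes "bij \<pi>" "\<Theta> \<subseteq>\<^sub>m \<Theta>B"
  shows "renames (env_of (perm_subst \<pi> \<Theta>B)) \<Theta> (perm_ctx \<pi> \<Theta>)"
  unfolding renames_def
proof (intro allI impI)
  fix h \<alpha>
  assume h: "\<Theta> h = Some \<alpha>"
  then have "\<Theta>B h = Some \<alpha>"
    using assms(2) by (metis domI map_le_def)
  \<comment> \<open>\<open>perm_subst\<close> omits fixed variables, so they are kept. For a moved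
    one the default \<open>Base\<close> does not arise, because \<open>\<Theta>B\<close> assigns
    \<open>h\<close> the arity \<open>\<alpha>\<close>.\<close>
  then have "env_of (perm_subst \<pi> \<Theta>B) h = Keep (perm_head \<pi> h) \<or>
      env_of (perm_subst \<pi> \<Theta>B) h = Repl (At (Hd (perm_head \<pi> h))) \<alpha>"
    by (cases h) (auto simp: perm_subst_def)
  then show "\<exists>h'. perm_ctx \<pi> \<Theta> h' = Some \<alpha> \<and> (env_of (perm_subst \<pi> \<Theta>B) h = Keep h' \<or>
      env_of (perm_subst \<pi> \<Theta>B) h = Repl (At (Hd h')) \<alpha>)"
    using perm_ctx_perm_head[OF assms(1)] h by metis
qed

lemma sig_arities_Var: "sig_arities \<Sigma> (Var x) = None"
  by (induction \<Sigma> rule: sig_arities.induct) auto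

lemma var_arities_Nil: "var_arities [] = Map.empty"
  by (simp add: var_arities_def)

lemma var_arities_Cons: "var_arities ((x, \<alpha>) # xs) = (var_arities xs)(Var x \<mapsto> \<alpha>)"
  by (simp add: var_arities_def)

lemma var_arities_append: "var_arities (xs @ ys) = var_arities ys ++ var_arities xs"
  by (simp add: var_arities_def)

text \<open>A signature assigns no variables, and \<open>perm_head\<close> moves nothing
  else.\<close>

lemma perm_ctx_sig_arities: "perm_ctx \<pi> (sig_arities \<Sigma>) = sig_arities \<Sigma>"
proof
  fix h
  show "perm_ctx \<pi> (sig_arities \<Sigma>) h = sig_arities \<Sigma> h"
    by (cases h) (auto simp: perm_ctx_def sig_arities_Var)
qed

text \<open>Identifies the transported starting context with the one in which the permuted
  declarations must be checked.\<close>

lemma perm_ctx_var_arities: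
  assumes "bij \<pi>"
  shows "perm_ctx \<pi> (sig_arities \<Sigma> ++ var_arities xs) =
    sig_arities \<Sigma> ++ var_arities (map (\<lambda>(x, \<alpha>). (\<pi> x, \<alpha>)) xs)"
  by (induction xs)
    (auto simp: var_arities_Nil var_arities_Cons perm_ctx_sig_arities perm_ctx_upd[OF assms])

text \<open>\<open>block_arities\<close> looks up the first declaration of a variable, \<open>wf_decl\<close> the last one;
  freshness of the declared variables makes the two agree.\<close>

lemma wf_decl_block_arities:
  assumes "wf_decl \<Sigma> (sig_arities \<Sigma> ++ var_arities xs) \<Delta> \<Theta>'"
  shows "\<Theta>' = block_arities \<Sigma> (Block xs \<Delta>)"
  using assms
proof (induction "sig_arities \<Sigma> ++ var_arities xs" \<Delta> \<Theta>' rule: wf_decl.induct)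
  case 1
  then show ?case by simp
next
  case (2 \<Delta> \<Theta>' y A)
  define zs where "zs = xs @ map (\<lambda>(y, A). (y, erase A)) \<Delta>"
  have \<Theta>': "\<Theta>' = sig_arities \<Sigma> ++ var_arities zs"
    using 2 by (simp add: zs_def)
  then have y: "var_arities zs (Var y) = None"
    using \<open>\<Theta>' (Var y) = None\<close> by (simp add: map_add_None)
  have "block_arities \<Sigma> (Block xs (\<Delta> @ [(y, A)])) =
      sig_arities \<Sigma> ++ var_arities (zs @ [(y, erase A)])"
    by (simp add: zs_def)
  also have "\<dots> = sig_arities \<Sigma> ++ ([Var y \<mapsto> erase A] ++ var_arities zs)"
    by (simp only: var_arities_append var_arities_Cons var_arities_Nil)
  also have "\<dots> = \<Theta>'(Var y \<mapsto> erase A)"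
    using y by (auto simp: \<Theta>' fun_eq_iff map_add_def split: option.splits)
  finally show ?case ..
qed

text \<open>\<open>wf_decl\<close> grows a list at its end, whereas \<open>those\<close> recurses
  from the front.\<close>

lemma those_snoc:
  "those (xs @ [Some y]) = map_option (\<lambda>ys. ys @ [y]) (those xs)"
  by (induction xs) (auto simp: option.map_comp comp_def split: option.splits)

text \<open>One substitution, annotated by \<open>\<Theta>B\<close>, serves all declarations. The
  induction therefore keeps \<open>\<Theta>B\<close> fixed while \<open>\<Theta>'\<close> ranges
  over the contexts of prefixes, which calls for inclusion rather than equality.\<close>

lemma wf_decl_perm:
  assumes "wf_decl \<Sigma> \<Theta> \<Delta> \<Theta>'" "bij \<pi>" "\<Theta>' \<subseteq>\<^sub>m \<Theta>B"
  shows "\<exists>\<Delta>'. those (map (\<lambda>(y, A). map_option (Pair (\<pi> y)) (subst_ty (perm_subst \<pi> \<Theta>B) A)) \<Delta>)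
      = Some \<Delta>' \<and> wf_decl \<Sigma> (perm_ctx \<pi> \<Theta>) \<Delta>' (perm_ctx \<pi> \<Theta>')"
  using assms
proof (induction rule: wf_decl.induct)
  case (1 \<Theta>)
  then show ?case by (auto intro: wf_decl.intros)
next
  case (2 \<Theta> \<Delta> \<Theta>' y A)
  \<comment> \<open>Undoing the update at \<open>y\<close> only shrinks the context, since
    \<open>y\<close> is fresh for \<open>\<Theta>'\<close>.\<close>
  have le: "\<Theta>' \<subseteq>\<^sub>m \<Theta>B"
    using 2 by (auto simp: map_le_def dom_def split: if_splits)
  then obtain \<Delta>' where \<Delta>':
    "those (map (\<lambda>(y, A). map_option (Pair (\<pi> y)) (subst_ty (perm_subst \<pi> \<Theta>B) A)) \<Delta>) = Some \<Delta>'"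
    "wf_decl \<Sigma> (perm_ctx \<pi> \<Theta>) \<Delta>' (perm_ctx \<pi> \<Theta>')"
    using 2 by blast
  obtain A' where A': "hsub_ty (env_of (perm_subst \<pi> \<Theta>B)) A A'" "arity_ty \<Sigma> (perm_ctx \<pi> \<Theta>') A'"
    "erase A' = erase A"
    using renames_ty[OF \<open>arity_ty \<Sigma> \<Theta>' A\<close> renames_perm_subst[OF \<open>bij \<pi>\<close> le]] by blast
  have "perm_ctx \<pi> \<Theta>' (Var (\<pi> y)) = None"
    using perm_ctx_perm_head[OF \<open>bij \<pi>\<close>, of \<Theta>' "Var y"] 2 by simp
  \<comment> \<open>The rule adds the erasure of the new type \<open>A'\<close>; it equals that of
    \<open>A\<close>, so the transported update results.\<close>
  then have "wf_decl \<Sigma> (perm_ctx \<pi> \<Theta>) (\<Delta>' @ [(\<pi> y, A')]) (perm_ctx \<pi> (\<Theta>'(Var y \<mapsto> erase A)))"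
    unfolding perm_ctx_upd[OF \<open>bij \<pi>\<close>] A'(3)[symmetric] using \<Delta>' A' by (intro wf_decl.intros)
  moreover have "subst_ty (perm_subst \<pi> \<Theta>B) A = Some A'"
    using A' by (simp add: subst_ty_eq_Some_iff)
  ultimately show ?case
    using \<Delta>' by (simp add: those_snoc fun_upd_def)
qed

theorem theorem4p6:
  fixes \<Sigma> :: signature and \<B> :: block_schema and \<pi> :: "name \<Rightarrow> name"
  assumes "wf_sig \<Sigma>"
    and "wf_block \<Sigma> \<B>"
    and "var_perm \<pi>"
  shows "\<exists>\<B>'. perm_block \<Sigma> \<pi> \<B> = Some \<B>' \<and> wf_block \<Sigma> \<B>'"
proof -
  have "bij \<pi>"
    using assms(3) by (simp add: var_perm_def)
  from assms(2) obtain xs \<Delta> \<Theta>' where \<B>: "\<B> = Block xs \<Delta>" and xs: "distinct (map fst xs)"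
    and \<Delta>: "wf_decl \<Sigma> (sig_arities \<Sigma> ++ var_arities xs) \<Delta> \<Theta>'"
    by (auto elim: wf_block.cases)
  define xs' where "xs' = map (\<lambda>(x, \<alpha>). (\<pi> x, \<alpha>)) xs"
  have "map fst xs' = map \<pi> (map fst xs)"
    by (auto simp: xs'_def)
  then have "distinct (map fst xs')"
    using xs \<open>bij \<pi>\<close> by (metis bij_is_inj distinct_map inj_on_subset subset_UNIV)
  \<comment> \<open>Here \<open>\<Theta>B\<close> is the final context \<open>\<Theta>'\<close>
    itself. Its identification with \<open>block_arities\<close> below makes this substitution the
    one used by \<open>perm_block\<close>.\<close>
  moreover obtain \<Delta>' where
    "those (map (\<lambda>(y, A). map_option (Pair (\<pi> y)) (subst_ty (perm_subst \<pi> \<Theta>') A)) \<Delta>) = Some \<Delta>'"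
    "wf_decl \<Sigma> (sig_arities \<Sigma> ++ var_arities xs') \<Delta>' (perm_ctx \<pi> \<Theta>')"
    using wf_decl_perm[OF \<Delta> \<open>bij \<pi>\<close> map_le_refl]
    unfolding perm_ctx_var_arities[OF \<open>bij \<pi>\<close>] xs'_def by blast
  moreover have "\<Theta>' = block_arities \<Sigma> (Block xs \<Delta>)"
    using \<Delta> by (rule wf_decl_block_arities)
  ultimately show ?thesis
    unfolding \<B> perm_block.simps Let_def xs'_def[symmetric]
    by (auto intro: wf_block.intros)
qed

end
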